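(* Let $p$ and $q$ be distinct primes, let $G$ be a cyclic group of order $p^2q^2$ with identity $e_G$, let $S_1=\{x\in G: |x|=p \text{ or } |x|=q\}$, $S_2=\{x\in G: |x|=p^2 \text{ or } |x|=q^2\}$, $S_3=\{e_G\}$. Then the Bi-Cayley graph $\Gamma=\mathrm{BiCay}(G;S_1,S_2,S_3)$ is connected.
   Context: $|x|$ denotes the order of the element $x$. For a group $G$ and nonempty subsets $S_1,S_2,S_3\subseteq G$ with $S_1,S_2,S_3$ inverse-closed and $e_G\notin S_1\cup S_2$, the Bi-Cayley graph $\mathrm{BiCay}(G;S_1,S_2,S_3)$ is the simple graph with vertex set $\{0,1\}\times G$ in which two distinct vertices $(i,x),(j,y)$ are adjacent iff: $xy^{-1}\in S_1$ when $i=j=0$; $xy^{-1}\in S_2$ when $i=j=1$; $xy^{-1}\in S_3$ when $i\ne j$. *)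

theory Defs
  imports
    "HOL-Computational_Algebra.Primes"
    "HOL-Algebra.Multiplicative_Group"
    "HOL-Algebra.Elementary_Groups"
    "Graph_Theory.Graph_Theory"
begin

text \<open>
  A simple graph is represented as a symmetric loop-free relation on its vertex set:
  every edge contributes both of its orientations. For data admissible in the sense of
  \<open>bicay_data\<close>, lemma \<open>bicay_bidirected\<close> shows that \<open>bicay\<close> is of this kind.
\<close>

definition bicay_data ::
  "('a, 'b) monoid_scheme \<Rightarrow> 'a set \<Rightarrow> 'a set \<Rightarrow> 'a set \<Rightarrow> bool" where
  "bicay_data G S\<^sub>1 S\<^sub>2 S\<^sub>3 \<longleftrightarrow>
     (\<forall>S \<in> {S\<^sub>1, S\<^sub>2, S\<^sub>3}. S \<subseteq> carrier G \<and> S \<noteq> {} \<and> (\<forall>x \<in> S. inv\<^bsub>G\<^esub> x \<in> S)) \<and>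
     \<one>\<^bsub>G\<^esub> \<notin> S\<^sub>1 \<union> S\<^sub>2"

definition bicay_adj ::
  "('a, 'b) monoid_scheme \<Rightarrow> 'a set \<Rightarrow> 'a set \<Rightarrow> 'a set \<Rightarrow> nat \<times> 'a \<Rightarrow> nat \<times> 'a \<Rightarrow> bool" where
  "bicay_adj G S\<^sub>1 S\<^sub>2 S\<^sub>3 u v \<longleftrightarrow>
     u \<noteq> v \<and>
     (case (u, v) of ((i, x), (j, y)) \<Rightarrow>
        (i = 0 \<and> j = 0 \<and> x \<otimes>\<^bsub>G\<^esub> inv\<^bsub>G\<^esub> y \<in> S\<^sub>1) \<or>
        (i = 1 \<and> j = 1 \<and> x \<otimes>\<^bsub>G\<^esub> inv\<^bsub>G\<^esub> y \<in> S\<^sub>2) \<or>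
        (i \<noteq> j \<and> x \<otimes>\<^bsub>G\<^esub> inv\<^bsub>G\<^esub> y \<in> S\<^sub>3))"

definition bicay ::
  "('a, 'b) monoid_scheme \<Rightarrow> 'a set \<Rightarrow> 'a set \<Rightarrow> 'a set \<Rightarrow> (nat \<times> 'a) pair_pre_digraph" where
  "bicay G S\<^sub>1 S\<^sub>2 S\<^sub>3 =
     \<lparr> pverts = {0, 1} \<times> carrier G,
       parcs = {(u, v). u \<in> {0, 1} \<times> carrier G \<and> v \<in> {0, 1} \<times> carrier G
                        \<and> bicay_adj G S\<^sub>1 S\<^sub>2 S\<^sub>3 u v} \<rparr>"

lemma bicay_adj_sym:
  fixes G (structure)
  assumes "group G" and data: "bicay_data G S\<^sub>1 S\<^sub>2 S\<^sub>3"
    and "u \<in> {0, 1} \<times> carrier G" "v \<in> {0, 1} \<times> carrier G"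
    and adj: "bicay_adj G S\<^sub>1 S\<^sub>2 S\<^sub>3 u v"
  shows "bicay_adj G S\<^sub>1 S\<^sub>2 S\<^sub>3 v u"
proof -
  interpret group G by fact
  obtain i x j y where uv: "u = (i, x)" "v = (j, y)" by (cases u, cases v)
  have xy: "x \<in> carrier G" "y \<in> carrier G" using assms uv by auto
  have "inv (x \<otimes> inv y) = y \<otimes> inv x" using xy by (simp add: inv_mult_group)
  then have "y \<otimes> inv x \<in> S" if "x \<otimes> inv y \<in> S" "S \<in> {S\<^sub>1, S\<^sub>2, S\<^sub>3}" for S
    using that data unfolding bicay_data_def by metis
  then show ?thesis using adj unfolding bicay_adj_def uv by auto
qed

lemma bicay_bidirected:
  assumes "group G" "bicay_data G S\<^sub>1 S\<^sub>2 S\<^sub>3"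
  shows "pair_bidirected_digraph (bicay G S\<^sub>1 S\<^sub>2 S\<^sub>3)"
proof
  show "symmetric (with_proj (bicay G S\<^sub>1 S\<^sub>2 S\<^sub>3))"
    using bicay_adj_sym[OF assms] by (auto simp: symmetric_def bicay_def intro!: symI)
qed (auto simp: bicay_def bicay_adj_def)

lemma bicay_data_cyclic:
  fixes G (structure) and p q :: nat
  assumes G: "group G" "cyclic_group G" "order G = p^2 * q^2"
    and pq: "Factorial_Ring.prime p" "Factorial_Ring.prime q" "p \<noteq> q"
  shows "bicay_data G
    {x \<in> carrier G. group.ord G x = p \<or> group.ord G x = q}
    {x \<in> carrier G. group.ord G x = p^2 \<or> group.ord G x = q^2}
    {\<one>}"
proof -
  interpret group G by fact
  obtain g where g: "g \<in> carrier G" "subgroup_generated G {g} = G"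
    using G(2) unfolding cyclic_group_def by blast
  have pos: "order G > 0" using G(3) pq by (simp add: prime_gt_0_nat)
  have ordg: "ord g = p^2 * q^2"
    using cyclic_order_is_ord[OF g(1)] g(2) G(3) by simp
  have ex: "\<exists>x \<in> carrier G. ord x = d" if "d dvd p^2 * q^2" for d
  proof -
    obtain k where k: "p^2 * q^2 = d * k" using \<open>d dvd p^2 * q^2\<close> by (elim dvdE)
    have k0: "k \<noteq> 0" and d0: "d \<noteq> 0" using k pos G(3) by auto
    have "ord (g [^] k) = d"
      using ord_pow[OF g(1), of k] k k0 d0 ordg by (simp add: ac_simps)
    then show ?thesis using g by blast
  qed
  have "\<exists>x \<in> carrier G. ord x = p" "\<exists>x \<in> carrier G. ord x = p^2"
    by (auto intro!: ex simp: power2_eq_square)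
  moreover have "ord \<one> = 1" by simp
  moreover have "p \<noteq> 1" "q \<noteq> 1" using pq by auto
  ultimately show ?thesis
    unfolding bicay_data_def by (auto simp: ord_inv power2_eq_square)
qed

end

theory Submission
  imports Defs
begin

text \<open>
  The rungs joining \<open>(0, x)\<close> to \<open>(1, x)\<close> let a path use the connection sets of both layers, so
  connectedness follows once \<open>S\<^sub>1 \<union> S\<^sub>2\<close> generates the group. For a generator \<open>g\<close> of the cyclic
  group, \<open>S\<^sub>2\<close> contains \<open>g ^ p\<^sup>2\<close> and \<open>g ^ q\<^sup>2\<close>, and a Bezout identity for the
  coprime numbers \<open>p\<^sup>2\<close> and \<open>q\<^sup>2\<close> recovers \<open>g\<close> from these two powers.
\<close>

lemma (in group) bicay_connected:
  assumes data: "bicay_data G S\<^sub>1 S\<^sub>2 S\<^sub>3"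
    and one: "\<one> \<in> S\<^sub>3"
    and gen: "generate G (S\<^sub>1 \<union> S\<^sub>2) = carrier G"
  shows "Digraph_Component.connected (with_proj (bicay G S\<^sub>1 S\<^sub>2 S\<^sub>3))"
proof -
  let ?D = "bicay G S\<^sub>1 S\<^sub>2 S\<^sub>3"
  interpret D: pair_bidirected_digraph ?D
    using bicay_bidirected[OF is_group data] .
  have vertex: "(i, x) \<in> pverts ?D" if "x \<in> carrier G" "i \<in> {0, 1}" for i x
    using that by (simp add: bicay_def)
  have edge: "u \<rightarrow>\<^sup>*\<^bsub>with_proj ?D\<^esub> v"
    if "u \<in> {0, 1} \<times> carrier G" "v \<in> {0, 1} \<times> carrier G" "bicay_adj G S\<^sub>1 S\<^sub>2 S\<^sub>3 u v" for u v
  proof -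
    have "(u, v) \<in> parcs ?D"
      using that by (simp add: bicay_def)
    then show ?thesis by (rule D.reachable_adjI)
  qed
  \<comment> \<open>For \<open>i \<noteq> j\<close> this is an edge, as
    \<open>x \<otimes> inv x = \<one>\<close> lies in \<open>S\<^sub>3\<close>; adjacency excludes
    loops, so for \<open>i = j\<close> the trivial path serves.\<close>
  have rung: "(i, x) \<rightarrow>\<^sup>*\<^bsub>with_proj ?D\<^esub> (j, x)"
    if "x \<in> carrier G" "i \<in> {0, 1}" "j \<in> {0, 1}" for i j :: nat and x
  proof (cases "i = j")
    case True
    then show ?thesis
      using D.reachable_refl[OF vertex[OF that(1,2)]] by simp
  next
    case False
    then show ?thesis
      using that one by (auto intro!: edge simp: bicay_adj_def)
  qed
  have step: "(1, x) \<rightarrow>\<^sup>*\<^bsub>with_proj ?D\<^esub> (1, h \<otimes> x)"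
    if h: "h \<in> S\<^sub>1 \<union> S\<^sub>2" and x: "x \<in> carrier G" for h x
  proof -
    \<comment> \<open>\<open>i\<close> is a layer whose connection set contains \<open>h\<close>:
      the path crosses to it, multiplies by \<open>h\<close> there, and returns to layer 1.\<close>
    define i :: nat where "i = (if h \<in> S\<^sub>1 then 0 else 1)"
    have hc: "h \<in> carrier G" and h1: "h \<noteq> \<one>"
      using h data unfolding bicay_data_def by auto
    have "x \<otimes> inv (h \<otimes> x) = inv h"
      using x hc by (simp add: inv_mult_group m_assoc[symmetric])
    moreover have "h \<in> S\<^sub>1 \<Longrightarrow> inv h \<in> S\<^sub>1" "h \<in> S\<^sub>2 \<Longrightarrow> inv h \<in> S\<^sub>2"
      using data unfolding bicay_data_def by auto
    \<comment> \<open>Adjacency demands distinct endpoints; this is where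
      \<open>\<one> \<notin> S\<^sub>1 \<union> S\<^sub>2\<close> enters.\<close>
    moreover have "x \<noteq> h \<otimes> x"
      using h1 hc x by (metis r_cancel_one)
    ultimately have "(i, x) \<rightarrow>\<^sup>*\<^bsub>with_proj ?D\<^esub> (i, h \<otimes> x)"
      using h hc x by (auto intro!: edge simp: bicay_adj_def i_def)
    moreover have "(1, x) \<rightarrow>\<^sup>*\<^bsub>with_proj ?D\<^esub> (i, x)"
      and "(i, h \<otimes> x) \<rightarrow>\<^sup>*\<^bsub>with_proj ?D\<^esub> (1, h \<otimes> x)"
      using rung[of x 1 i] rung[of "h \<otimes> x" i 1] hc x by (simp_all add: i_def)
    ultimately show ?thesis
      by (meson D.reachable_trans)
  qed
  have translate: "(1, x) \<rightarrow>\<^sup>*\<^bsub>with_proj ?D\<^esub> (1, h \<otimes> x)"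
    if "h \<in> generate G (S\<^sub>1 \<union> S\<^sub>2)" "x \<in> carrier G" for h x
    using that
  \<comment> \<open>The base point varies because a product \<open>h1 \<otimes> h2\<close> is
    handled by going from \<open>x\<close> to \<open>h2 \<otimes> x\<close> and then applying the
    hypothesis for \<open>h1\<close> there.\<close>
  proof (induction arbitrary: x rule: generate.induct)
    case one
    then show ?case using rung[of x 1 1] by simp
  next
    case (incl h)
    then show ?case using step by blast
  next
    case (inv h)
    then have "inv h \<in> S\<^sub>1 \<union> S\<^sub>2"
      using data unfolding bicay_data_def by auto
    then show ?case using step inv.prems by blast
  next
    case (eng h1 h2)
    then have "h1 \<in> carrier G" "h2 \<in> carrier G" using gen by auto
    then show ?case
      using eng.IH(2)[OF eng.prems] eng.IH(1)[of "h2 \<otimes> x"] eng.prems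
      by (auto simp: m_assoc intro: D.reachable_trans)
  qed
  have reach: "(i, x) \<rightarrow>\<^sup>*\<^bsub>with_proj ?D\<^esub> (j, y)"
    if "x \<in> carrier G" "y \<in> carrier G" "i \<in> {0, 1}" "j \<in> {0, 1}" for i j :: nat and x y
  proof -
    \<comment> \<open>The translation by \<open>y \<otimes> inv x\<close> carries \<open>x\<close>
      to \<open>y\<close>, and by \<open>gen\<close> every element of the group is an available
      translation.\<close>
    have "(1, x) \<rightarrow>\<^sup>*\<^bsub>with_proj ?D\<^esub> (1, y)"
      using translate[of "y \<otimes> inv x" x] that gen by (simp add: m_assoc)
    then show ?thesis
      using rung[of x i 1] rung[of y 1 j] that by (meson D.reachable_trans insertCI)
  qed
  \<comment> \<open>Connectedness is strong connectedness of the symmetric closure; as the arcs are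
    already symmetric, the closure has the same reachability.\<close>
  have "strongly_connected (with_proj ?D)"
    using reach by (intro strongly_connectedI) (auto simp: bicay_def)
  then show ?thesis
    unfolding Digraph_Component.connected_def strongly_connected_def
    by (simp add: D.reachable_mk_symmetric_eq[OF D.sym_arcs])
qed

text \<open>Some integer combination of \<open>m\<close> and \<open>n\<close> equals 1, and the same
  combination of exponents yields \<open>g\<close>. Only exponents are compared, so the order of
  \<open>g\<close> may be infinite.\<close>

lemma (in group) generate_coprime_powers:
  fixes m n :: nat
  assumes g: "g \<in> carrier G" and "coprime m n" "m \<noteq> 0"
    and S: "S \<subseteq> carrier G" "g [^] m \<in> S" "g [^] n \<in> S"
  shows "generate G {g} \<subseteq> generate G S"
proof -
  have sub: "subgroup (generate G S) G"
    using S(1) by (rule generate_is_subgroup)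
  \<comment> \<open>Bezout over the naturals, with the negative coefficient moved across. For
    \<open>m = 0\<close>, \<open>n = 1\<close> no such pair exists, hence
    \<open>m \<noteq> 0\<close>.\<close>
  obtain x y where xy: "m * x = n * y + 1"
    using bezout_nat[OF \<open>m \<noteq> 0\<close>, of n] \<open>coprime m n\<close> by auto
  have "(g [^] m) [^] x = (g [^] n) [^] y \<otimes> g"
    using g xy by (simp add: nat_pow_pow)
  then have "g = inv ((g [^] n) [^] y) \<otimes> (g [^] m) [^] x"
    using g by (simp add: m_assoc[symmetric])
  moreover have "(g [^] k) [^] z \<in> generate G S" if "g [^] k \<in> S" for k z :: nat
    using subgroup_int_pow_closed[OF sub, of "g [^] k" "int z"] that
    by (simp add: generate.incl int_pow_int)
  ultimately have "g \<in> generate G S"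
    using S sub by (metis subgroup.m_closed subgroup.m_inv_closed)
  then show ?thesis
    using sub by (intro generate_subgroup_incl) auto
qed

theorem theorem2p9:
  fixes G :: "('a, 'b) monoid_scheme"
    and p q :: nat
    and S\<^sub>1 S\<^sub>2 S\<^sub>3 :: "'a set"
  assumes "Factorial_Ring.prime p" and "Factorial_Ring.prime q" and "p \<noteq> q"
    and "group G" and "cyclic_group G" and "order G = p^2 * q^2"
    and "S\<^sub>1 = {x \<in> carrier G. group.ord G x = p \<or> group.ord G x = q}"
    and "S\<^sub>2 = {x \<in> carrier G. group.ord G x = p^2 \<or> group.ord G x = q^2}"
    and "S\<^sub>3 = {\<one>\<^bsub>G\<^esub>}"
  shows "Digraph_Component.connected (with_proj (bicay G S\<^sub>1 S\<^sub>2 S\<^sub>3))"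
proof -
  interpret group G by fact
  obtain g where g: "g \<in> carrier G" "subgroup_generated G {g} = G"
    using assms(5) unfolding cyclic_group_def by blast
  have carrier: "carrier G = generate G {g}"
    using arg_cong[OF g(2), of carrier] g(1) by (simp add: carrier_subgroup_generated)
  have ordg: "ord g = p^2 * q^2"
    using cyclic_order_is_ord[OF g(1)] g(2) assms(6) by simp
  have nz: "p \<noteq> 0" "q \<noteq> 0"
    using assms(1,2) by auto
  \<comment> \<open>Since \<open>p^2\<close> and \<open>q^2\<close> divide \<open>ord g\<close>,
    these powers have orders \<open>q^2\<close> and \<open>p^2\<close>, so both lie in
    \<open>S\<^sub>2\<close>.\<close>
  have "g [^]\<^bsub>G\<^esub> (p^2) \<in> S\<^sub>1 \<union> S\<^sub>2" "g [^]\<^bsub>G\<^esub> (q^2) \<in> S\<^sub>1 \<union> S\<^sub>2"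
    using g(1) nz ordg by (simp_all add: assms(8) ord_pow)
  moreover have "S\<^sub>1 \<union> S\<^sub>2 \<subseteq> carrier G"
    using assms(7,8) by auto
  moreover have "coprime (p^2) (q^2)"
    using assms(1-3) by (simp add: primes_coprime)
  ultimately have "generate G {g} \<subseteq> generate G (S\<^sub>1 \<union> S\<^sub>2)"
    using g(1) nz by (intro generate_coprime_powers[of g "p^2" "q^2"]) simp_all
  then have "generate G (S\<^sub>1 \<union> S\<^sub>2) = carrier G"
    using generate_incl[of "S\<^sub>1 \<union> S\<^sub>2"] \<open>S\<^sub>1 \<union> S\<^sub>2 \<subseteq> carrier G\<close> carrier by blast
  moreover have "bicay_data G S\<^sub>1 S\<^sub>2 S\<^sub>3"
    using bicay_data_cyclic[OF assms(4-6,1-3)] by (simp add: assms(7-9))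
  ultimately show ?thesis
    using assms(9) by (intro bicay_connected) auto
qed

end
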